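(* Let $A$ be a commutative (not necessarily associative) $C$-algebra with a Frobenius form $(\cdot,\cdot)$, and let $a\in A$ be an anisotropic primitive $S$-axis satisfying the basic fusion rules. Then $A_0(a)^2\subseteq A_0(a)$, i.e. $yz\in A_0(a)$ for all $y,z\in A_0(a)$.
   Context: $C$ is a commutative Noetherian ring containing $\frac12$. For an idempotent $a$ of a commutative $C$-algebra $A$ and $\mu\in C$, put $A_\mu(a)=\{y\in A: ay=\mu y\}$ and $A_{0,1}(a)=A_1(a)+A_0(a)$. Let $S\subseteq C\setminus\{0,1\}$ be a set such that $\lambda$, $1-\lambda$ and $\lambda-\lambda'$ are invertible in $C$ for all distinct $\lambda,\lambda'\in S$. An $S$-axis is an idempotent $a\in A$ with $A=A_1(a)\oplus A_0(a)\oplus\bigoplus_{\lambda\in S}A_\lambda(a)$. It is primitive if $A_1(a)=Ca$. The basic fusion rules for $a$ are: (a) $A_{0,1}(a)$ is a $C$-subalgebra of $A$; (b) $A_{0,1}(a)A_\lambda(a)\subseteq A_\lambda(a)$ for each $\lambda\in S$. A Frobenius form is a symmetric $C$-bilinear form $(\cdot,\cdot):A\times A\to C$ with $(xy,z)=(x,yz)$ for all $x,y,z\in A$. An axis $a$ is anisotropic if $(a,a)$ is invertible in $C$. *)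

theory Defs
  imports "HOL-Algebra.Ring_Divisibility" "HOL-Algebra.Module"
begin

text \<open>The record type of modules extends that of rings, so it carries a multiplication.
  The locale \<^locale>\<open>module\<close> assumes nothing about that multiplication, nor about the unit
  field of the record, which stays unconstrained below.\<close>

locale comm_nonassoc_algebra = module C A for C (structure) and A (structure) +
  assumes mult_closed:
      "\<lbrakk>x \<in> carrier A; y \<in> carrier A\<rbrakk> \<Longrightarrow> x \<otimes>\<^bsub>A\<^esub> y \<in> carrier A"
    and mult_comm:
      "\<lbrakk>x \<in> carrier A; y \<in> carrier A\<rbrakk> \<Longrightarrow> x \<otimes>\<^bsub>A\<^esub> y = y \<otimes>\<^bsub>A\<^esub> x"
    and mult_l_distr:
      "\<lbrakk>x \<in> carrier A; y \<in> carrier A; z \<in> carrier A\<rbrakk> \<Longrightarrow>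
        (x \<oplus>\<^bsub>A\<^esub> y) \<otimes>\<^bsub>A\<^esub> z = x \<otimes>\<^bsub>A\<^esub> z \<oplus>\<^bsub>A\<^esub> y \<otimes>\<^bsub>A\<^esub> z"
    and mult_smult:
      "\<lbrakk>c \<in> carrier C; x \<in> carrier A; y \<in> carrier A\<rbrakk> \<Longrightarrow>
        (c \<odot>\<^bsub>A\<^esub> x) \<otimes>\<^bsub>A\<^esub> y = c \<odot>\<^bsub>A\<^esub> (x \<otimes>\<^bsub>A\<^esub> y)"

definition nonassoc_subalgebra ::
  "('c, 'k) ring_scheme \<Rightarrow> ('c, 'a, 'm) module_scheme \<Rightarrow> 'a set \<Rightarrow> bool" where
  "nonassoc_subalgebra C A B \<longleftrightarrow>
     submodule B C A \<and> (\<forall>x\<in>B. \<forall>y\<in>B. x \<otimes>\<^bsub>A\<^esub> y \<in> B)"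

definition eigenspace ::
  "('c, 'a, 'm) module_scheme \<Rightarrow> 'a \<Rightarrow> 'c \<Rightarrow> 'a set" where
  "eigenspace A a \<mu> = {y \<in> carrier A. a \<otimes>\<^bsub>A\<^esub> y = \<mu> \<odot>\<^bsub>A\<^esub> y}"

definition eigenspace01 ::
  "('c, 'k) ring_scheme \<Rightarrow> ('c, 'a, 'm) module_scheme \<Rightarrow> 'a \<Rightarrow> 'a set" where
  "eigenspace01 C A a = eigenspace A a \<one>\<^bsub>C\<^esub> <+>\<^bsub>A\<^esub> eigenspace A a \<zero>\<^bsub>C\<^esub>"

text \<open>Internal direct sum of a family of submodules, for a possibly infinite index set:
  each element is in exactly one way a sum of a finitely supported choice of components.\<close>

definition internal_direct_sum ::
  "('c, 'a, 'm) module_scheme \<Rightarrow> 'i set \<Rightarrow> ('i \<Rightarrow> 'a set) \<Rightarrow> bool" where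
  "internal_direct_sum A I V \<longleftrightarrow>
     (\<forall>x\<in>carrier A. \<exists>!f. f \<in> (\<Pi>\<^sub>E i\<in>I. V i) \<and> finite {i\<in>I. f i \<noteq> \<zero>\<^bsub>A\<^esub>} \<and>
        x = (\<Oplus>\<^bsub>A\<^esub>i\<in>{i\<in>I. f i \<noteq> \<zero>\<^bsub>A\<^esub>}. f i))"

definition admissible_eigenvalues :: "('c, 'k) ring_scheme \<Rightarrow> 'c set \<Rightarrow> bool" where
  "admissible_eigenvalues C S \<longleftrightarrow>
     S \<subseteq> carrier C - {\<zero>\<^bsub>C\<^esub>, \<one>\<^bsub>C\<^esub>} \<and>
     (\<forall>\<mu>\<in>S. \<mu> \<in> Units C \<and> \<one>\<^bsub>C\<^esub> \<ominus>\<^bsub>C\<^esub> \<mu> \<in> Units C) \<and>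
     (\<forall>\<mu>\<in>S. \<forall>\<nu>\<in>S. \<mu> \<noteq> \<nu> \<longrightarrow> \<mu> \<ominus>\<^bsub>C\<^esub> \<nu> \<in> Units C)"

text \<open>Indexing the summands by the eigenvalues themselves is harmless even if \<open>C\<close> is the
  zero ring, where the indices 0 and 1 coincide, because then \<open>A\<close> is zero.\<close>

definition is_axis ::
  "('c, 'k) ring_scheme \<Rightarrow> ('c, 'a, 'm) module_scheme \<Rightarrow> 'c set \<Rightarrow> 'a \<Rightarrow> bool" where
  "is_axis C A S a \<longleftrightarrow>
     a \<in> carrier A \<and> a \<otimes>\<^bsub>A\<^esub> a = a \<and>
     internal_direct_sum A ({\<one>\<^bsub>C\<^esub>, \<zero>\<^bsub>C\<^esub>} \<union> S) (eigenspace A a)"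

definition primitive ::
  "('c, 'k) ring_scheme \<Rightarrow> ('c, 'a, 'm) module_scheme \<Rightarrow> 'a \<Rightarrow> bool" where
  "primitive C A a \<longleftrightarrow> eigenspace A a \<one>\<^bsub>C\<^esub> = {c \<odot>\<^bsub>A\<^esub> a |c. c \<in> carrier C}"

definition basic_fusion_rules ::
  "('c, 'k) ring_scheme \<Rightarrow> ('c, 'a, 'm) module_scheme \<Rightarrow> 'c set \<Rightarrow> 'a \<Rightarrow> bool" where
  "basic_fusion_rules C A S a \<longleftrightarrow>
     nonassoc_subalgebra C A (eigenspace01 C A a) \<and>
     (\<forall>\<mu>\<in>S. \<forall>y\<in>eigenspace01 C A a. \<forall>z\<in>eigenspace A a \<mu>. y \<otimes>\<^bsub>A\<^esub> z \<in> eigenspace A a \<mu>)"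

locale frobenius_form = comm_nonassoc_algebra C A for C (structure) and A (structure) +
  fixes form
  assumes form_closed:
      "\<lbrakk>x \<in> carrier A; y \<in> carrier A\<rbrakk> \<Longrightarrow> form x y \<in> carrier C"
    and form_sym:
      "\<lbrakk>x \<in> carrier A; y \<in> carrier A\<rbrakk> \<Longrightarrow> form x y = form y x"
    and form_add:
      "\<lbrakk>x \<in> carrier A; y \<in> carrier A; z \<in> carrier A\<rbrakk> \<Longrightarrow>
        form (x \<oplus>\<^bsub>A\<^esub> y) z = form x z \<oplus>\<^bsub>C\<^esub> form y z"
    and form_smult:
      "\<lbrakk>c \<in> carrier C; x \<in> carrier A; y \<in> carrier A\<rbrakk> \<Longrightarrow>
        form (c \<odot>\<^bsub>A\<^esub> x) y = c \<otimes>\<^bsub>C\<^esub> form x y"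
    and form_assoc:
      "\<lbrakk>x \<in> carrier A; y \<in> carrier A; z \<in> carrier A\<rbrakk> \<Longrightarrow>
        form (x \<otimes>\<^bsub>A\<^esub> y) z = form x (y \<otimes>\<^bsub>A\<^esub> z)"

definition anisotropic ::
  "('c, 'k) ring_scheme \<Rightarrow> ('a \<Rightarrow> 'a \<Rightarrow> 'c) \<Rightarrow> 'a \<Rightarrow> bool" where
  "anisotropic C form a \<longleftrightarrow> form a a \<in> Units C"

end

theory Submission
  imports Defs
begin

text \<open>The fusion rules give \<open>y z = c a + w\<close> with \<open>w\<close> in the 0-eigenspace. That eigenspace is
  orthogonal to \<open>a\<close>, and \<open>(a, y z) = (a y, z) = 0\<close>; hence \<open>c (a, a) = 0\<close>, and \<open>c = 0\<close> by
  anisotropy.\<close>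

lemma (in comm_nonassoc_algebra) mult_zero_left:
  assumes "x \<in> carrier A"
  shows "\<zero>\<^bsub>A\<^esub> \<otimes>\<^bsub>A\<^esub> x = \<zero>\<^bsub>A\<^esub>"
  using mult_smult[of "\<zero>" "\<zero>\<^bsub>A\<^esub>" x] mult_closed[of "\<zero>\<^bsub>A\<^esub>" x] assms
  by (simp add: smult_l_null)

lemma (in comm_nonassoc_algebra) eigenspace_zero_iff:
  "y \<in> eigenspace A a \<zero> \<longleftrightarrow> y \<in> carrier A \<and> a \<otimes>\<^bsub>A\<^esub> y = \<zero>\<^bsub>A\<^esub>"
  by (auto simp: eigenspace_def smult_l_null)

text \<open>Zero is also a 1-eigenvector, so \<open>y\<close> decomposes as 0 + \<open>y\<close>.
  This lets the subalgebra rule act on products of 0-eigenvectors.\<close>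

lemma (in comm_nonassoc_algebra) eigenspace_zero_subset_eigenspace01:
  assumes "a \<in> carrier A"
  shows "eigenspace A a \<zero> \<subseteq> eigenspace01 C A a"
proof
  fix y assume y: "y \<in> eigenspace A a \<zero>"
  have "\<zero>\<^bsub>A\<^esub> \<in> eigenspace A a \<one>"
    using assms mult_comm[of a "\<zero>\<^bsub>A\<^esub>"] by (simp add: eigenspace_def mult_zero_left)
  moreover have "y = \<zero>\<^bsub>A\<^esub> \<oplus>\<^bsub>A\<^esub> y"
    using y by (simp add: eigenspace_zero_iff)
  ultimately show "y \<in> eigenspace01 C A a"
    using y unfolding eigenspace01_def set_add_def' by blast
qed

lemma (in frobenius_form) form_zero_left:
  assumes "x \<in> carrier A"
  shows "form \<zero>\<^bsub>A\<^esub> x = \<zero>"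
  using form_smult[of "\<zero>" "\<zero>\<^bsub>A\<^esub>" x] form_closed[of "\<zero>\<^bsub>A\<^esub>" x] assms
  by (simp add: smult_l_null)

text \<open>By symmetry and associativity of the form, (\<open>y z\<close>, \<open>a\<close>) =
  (\<open>a\<close>, \<open>y z\<close>) = (\<open>a y\<close>, \<open>z\<close>), and
  \<open>a y\<close> = 0. The factor \<open>z\<close> is arbitrary, so that \<open>z\<close> =
  \<open>a\<close> is allowed as well.\<close>

lemma (in frobenius_form) form_mult_eigenspace_zero:
  assumes "a \<in> carrier A" "y \<in> eigenspace A a \<zero>" "z \<in> carrier A"
  shows "form (y \<otimes>\<^bsub>A\<^esub> z) a = \<zero>"
  using assms form_assoc[of a y z] form_sym[of a "y \<otimes>\<^bsub>A\<^esub> z"]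
  by (simp add: eigenspace_zero_iff form_zero_left mult_closed)

text \<open>Idempotency gives (\<open>w\<close>, \<open>a\<close>) = (\<open>w\<close>,
  \<open>a a\<close>) = (\<open>w a\<close>, \<open>a\<close>), which is the previous lemma at
  \<open>z\<close> = \<open>a\<close>.\<close>

lemma (in frobenius_form) form_eigenspace_zero:
  assumes "a \<in> carrier A" "a \<otimes>\<^bsub>A\<^esub> a = a" "w \<in> eigenspace A a \<zero>"
  shows "form w a = \<zero>"
  using form_mult_eigenspace_zero[OF assms(1,3,1)] form_assoc[of w a a] assms
  by (simp add: eigenspace_zero_iff)

theorem theorem3p1:
  fixes C :: "('c, 'k) ring_scheme" and A :: "('c, 'a, 'm) module_scheme"
    and form :: "'a \<Rightarrow> 'a \<Rightarrow> 'c" and S :: "'c set" and a :: 'a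
  assumes "cring C" and "noetherian_ring C"
    and "\<one>\<^bsub>C\<^esub> \<oplus>\<^bsub>C\<^esub> \<one>\<^bsub>C\<^esub> \<in> Units C"
    and "admissible_eigenvalues C S"
    and "comm_nonassoc_algebra C A"
    and "frobenius_form C A form"
    and "is_axis C A S a" and "primitive C A a" and "anisotropic C form a"
    and "basic_fusion_rules C A S a"
  shows "\<forall>y \<in> eigenspace A a \<zero>\<^bsub>C\<^esub>. \<forall>z \<in> eigenspace A a \<zero>\<^bsub>C\<^esub>.
           y \<otimes>\<^bsub>A\<^esub> z \<in> eigenspace A a \<zero>\<^bsub>C\<^esub>"
proof (intro ballI)
  interpret frobenius_form C A form by fact
  fix y z assume y: "y \<in> eigenspace A a \<zero>\<^bsub>C\<^esub>" and z: "z \<in> eigenspace A a \<zero>\<^bsub>C\<^esub>"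
  have a: "a \<in> carrier A" "a \<otimes>\<^bsub>A\<^esub> a = a"
    using \<open>is_axis C A S a\<close> by (auto simp: is_axis_def)
  have "y \<otimes>\<^bsub>A\<^esub> z \<in> eigenspace01 C A a"
    using \<open>basic_fusion_rules C A S a\<close> y z eigenspace_zero_subset_eigenspace01[OF a(1)]
    unfolding basic_fusion_rules_def nonassoc_subalgebra_def by blast
  \<comment> \<open>Primitivity turns the 1-component of the product into a scalar multiple of
    \<open>a\<close>.\<close>
  then obtain c w where c: "c \<in> carrier C" and w: "w \<in> eigenspace A a \<zero>\<^bsub>C\<^esub>"
    and yz: "y \<otimes>\<^bsub>A\<^esub> z = c \<odot>\<^bsub>A\<^esub> a \<oplus>\<^bsub>A\<^esub> w"
    using \<open>primitive C A a\<close>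
    unfolding eigenspace01_def set_add_def' primitive_def by auto
  have w_carrier: "w \<in> carrier A"
    using w by (simp add: eigenspace_zero_iff)
  have unit: "form a a \<in> Units C"
    using \<open>anisotropic C form a\<close> by (simp add: anisotropic_def)
  have "form (y \<otimes>\<^bsub>A\<^esub> z) a = \<zero>\<^bsub>C\<^esub>"
    using form_mult_eigenspace_zero[OF a(1) y] z by (simp add: eigenspace_zero_iff)
  \<comment> \<open>Pairing the decomposition with \<open>a\<close> kills \<open>w\<close>, leaving
    only the contribution of \<open>c\<close>.\<close>
  then have "c \<otimes>\<^bsub>C\<^esub> form a a = \<zero>\<^bsub>C\<^esub>"
    unfolding yz using c a w_carrier form_eigenspace_zero[OF a w]
    by (simp add: form_add form_smult form_closed)
  \<comment> \<open>Both sides are written as multiples of \<open>form a a\<close>, with the unit on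
    the left, to match the shape of the cancellation law.\<close>
  then have "form a a \<otimes>\<^bsub>C\<^esub> c = form a a \<otimes>\<^bsub>C\<^esub> \<zero>\<^bsub>C\<^esub>"
    using c unit by (simp add: R.m_comm R.Units_closed)
  then have "c = \<zero>\<^bsub>C\<^esub>"
    using R.Units_l_cancel[OF unit c] by simp
  \<comment> \<open>With \<open>c\<close> = 0 the product is \<open>w\<close> itself.\<close>
  then show "y \<otimes>\<^bsub>A\<^esub> z \<in> eigenspace A a \<zero>\<^bsub>C\<^esub>"
    using yz w w_carrier a by (simp add: smult_l_null)
qed

end
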